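(* For every integer $n\geq 1$, the following polynomial identities hold: $$R_{n+1}(x)=\sum_{k=0}^n\binom{n}{k}T_k(x)T_{n-k}(x),$$ $$R_{n+2}(x)=2\sum_{k=0}^n\binom{n}{k}T_k(x)T_{n-k+1}(x),$$ $$R_{n+2}(x)=2x\sum_{k=0}^n\binom{n}{k}R_{k+1}(x)\widetilde{W}_{n-k}(x^2),$$ $$T_{n+1}(x)=x\sum_{k=0}^n\binom{n}{k}T_k(x)\widetilde{W}_{n-k}(x^2),$$ $$T_{n+1}(x)=T_n(x)+x^2\sum_{k=0}^{n-1}\binom{n}{k}T_k(x)W_{n-k}(x^2).$$
   Context: $\mathfrak{S}_n$ is the set of permutations $\pi=\pi(1)\cdots\pi(n)$ of $\{1,\ldots,n\}$. Alternating runs: $\pi$ changes direction at position $i\in\{2,\ldots,n-1\}$ if $\pi(i-1)<\pi(i)>\pi(i+1)$ or $\pi(i-1)>\pi(i)<\pi(i+1)$. For $n\ge 2$, $\pi$ has $k$ alternating runs if it changes direction at exactly $k-1$ positions; $R(n,k)$ is the number of $\pi\in\mathfrak{S}_n$ with $k$ alternating runs. Put $R_n(x)=\sum_{k=1}^{n-1}R(n,k)x^k$ for $n\ge 2$, and by convention $R_1(x)=1$. Longest alternating subsequences: an alternating subsequence of $\pi$ of length $k$ is a subsequence $\pi(i_1),\ldots,\pi(i_k)$ with $i_1<\cdots<i_k$ and $\pi(i_1)>\pi(i_2)<\pi(i_3)>\cdots\pi(i_k)$ (starting with a descent and alternating thereafter; any sequence of length 1 qualifies). $\mathrm{as}(\pi)$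 is the maximal length of an alternating subsequence, $a_k(n)=\#\{\pi\in\mathfrak{S}_n:\mathrm{as}(\pi)=k\}$, $T_n(x)=\sum_{k=1}^n a_k(n)x^k$ for $n\ge 1$, and $T_0(x)=1$. Peaks: an interior peak of $\pi\in\mathfrak{S}_n$ is an index $i\in\{2,\ldots,n-1\}$ with $\pi(i-1)<\pi(i)>\pi(i+1)$; a left peak is an index $i\in\{1,\ldots,n-1\}$ with $\pi(i-1)<\pi(i)>\pi(i+1)$, where $\pi(0)=0$. $W(n,k)$ (resp. $\widetilde{W}(n,k)$) is the number of $\pi\in\mathfrak{S}_n$ with $k$ interior peaks (resp. $k$ left peaks). For $n\ge 1$, $W_n(x)=\sum_{k\ge 0}W(n,k)x^k$ and $\widetilde{W}_n(x)=\sum_{k\ge 0}\widetilde{W}(n,k)x^k$; also $\widetilde{W}_0(x)=1$. *)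

theory Defs
  imports
    "HOL-Combinatorics.Permutations"
    "HOL-Computational_Algebra.Polynomial"
begin

text \<open>
  An element of $S_n$ is a function \<open>\<pi>\<close> with \<open>\<pi> permutes {1..n}\<close>. Such a function is the
  identity outside \<open>{1..n}\<close>; in particular \<open>\<pi> 0 = 0\<close>, as required for left peaks.
\<close>

definition perms :: "nat \<Rightarrow> (nat \<Rightarrow> nat) set" where
  "perms n = {\<pi>. \<pi> permutes {1..n}}"

definition changes_direction_at :: "(nat \<Rightarrow> nat) \<Rightarrow> nat \<Rightarrow> bool" where
  "changes_direction_at \<pi> i \<longleftrightarrow>
     (\<pi> (i - 1) < \<pi> i \<and> \<pi> i > \<pi> (i + 1)) \<or> (\<pi> (i - 1) > \<pi> i \<and> \<pi> i < \<pi> (i + 1))"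

text \<open>Only meaningful for \<open>n \<ge> 2\<close>.\<close>

definition alt_runs :: "nat \<Rightarrow> (nat \<Rightarrow> nat) \<Rightarrow> nat" where
  "alt_runs n \<pi> = card {i \<in> {2..n - 1}. changes_direction_at \<pi> i} + 1"

definition R_num :: "nat \<Rightarrow> nat \<Rightarrow> nat" where
  "R_num n k = card {\<pi> \<in> perms n. alt_runs n \<pi> = k}"

text \<open>Only meaningful for \<open>n \<ge> 1\<close>.\<close>

definition R_poly :: "nat \<Rightarrow> int poly" where
  "R_poly n = (if n = 1 then 1 else (\<Sum>k = 1..n - 1. monom (int (R_num n k)) k))"

text \<open>
  List positions start at 0, so the descents of an alternating sequence
  $x_1 > x_2 < x_3 > \cdots$ are at even positions.
\<close>

definition alternating :: "nat list \<Rightarrow> bool" where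
  "alternating xs \<longleftrightarrow>
     (\<forall>j. j + 1 < length xs \<longrightarrow>
        (if even j then xs ! j > xs ! (j + 1) else xs ! j < xs ! (j + 1)))"

text \<open>
  A subsequence is given by the strictly increasing list of its indices. The empty list is
  admitted, which does not affect the maximum when \<open>n \<ge> 1\<close>.
\<close>

definition longest_alt :: "nat \<Rightarrow> (nat \<Rightarrow> nat) \<Rightarrow> nat" where
  "longest_alt n \<pi> =
     Max {length js | js. sorted_wrt (<) js \<and> set js \<subseteq> {1..n} \<and> alternating (map \<pi> js)}"

definition a_num :: "nat \<Rightarrow> nat \<Rightarrow> nat" where
  "a_num k n = card {\<pi> \<in> perms n. longest_alt n \<pi> = k}"

definition T_poly :: "nat \<Rightarrow> int poly" where
  "T_poly n = (if n = 0 then 1 else (\<Sum>k = 1..n. monom (int (a_num k n)) k))"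

definition interior_peaks :: "nat \<Rightarrow> (nat \<Rightarrow> nat) \<Rightarrow> nat set" where
  "interior_peaks n \<pi> = {i \<in> {2..n - 1}. \<pi> (i - 1) < \<pi> i \<and> \<pi> i > \<pi> (i + 1)}"

definition left_peaks :: "nat \<Rightarrow> (nat \<Rightarrow> nat) \<Rightarrow> nat set" where
  "left_peaks n \<pi> = {i \<in> {1..n - 1}. \<pi> (i - 1) < \<pi> i \<and> \<pi> i > \<pi> (i + 1)}"

definition W_num :: "nat \<Rightarrow> nat \<Rightarrow> nat" where
  "W_num n k = card {\<pi> \<in> perms n. card (interior_peaks n \<pi>) = k}"

definition LW_num :: "nat \<Rightarrow> nat \<Rightarrow> nat" where
  "LW_num n k = card {\<pi> \<in> perms n. card (left_peaks n \<pi>) = k}"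

text \<open>
  The sums over all \<open>k \<ge> 0\<close> are cut off at \<open>n\<close>, beyond which all coefficients vanish: see
  \<open>coeff_W_poly\<close> and \<open>coeff_LW_poly\<close> below.
\<close>

definition W_poly :: "nat \<Rightarrow> int poly" where
  "W_poly n = (\<Sum>k\<le>n. monom (int (W_num n k)) k)"

definition LW_poly :: "nat \<Rightarrow> int poly" where
  "LW_poly n = (\<Sum>k\<le>n. monom (int (LW_num n k)) k)"

lemma card_interior_peaks_le: "card (interior_peaks n \<pi>) \<le> n"
proof -
  have "card (interior_peaks n \<pi>) \<le> card {1..n}"
    by (rule card_mono) (auto simp: interior_peaks_def)
  then show ?thesis by simp
qed

lemma card_left_peaks_le: "card (left_peaks n \<pi>) \<le> n"
proof -
  have "card (left_peaks n \<pi>) \<le> card {1..n}"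
    by (rule card_mono) (auto simp: left_peaks_def)
  then show ?thesis by simp
qed

lemma coeff_W_poly: "coeff (W_poly n) k = int (W_num n k)"
proof -
  have "W_num n k = 0" if "k > n"
  proof -
    have "card (interior_peaks n \<pi>) \<noteq> k" for \<pi>
      using card_interior_peaks_le[of n \<pi>] that by simp
    then show ?thesis by (simp add: W_num_def)
  qed
  then show ?thesis
    by (cases "k \<le> n") (auto simp: W_poly_def coeff_sum)
qed

lemma coeff_LW_poly: "coeff (LW_poly n) k = int (LW_num n k)"
proof -
  have "LW_num n k = 0" if "k > n"
  proof -
    have "card (left_peaks n \<pi>) \<noteq> k" for \<pi>
      using card_left_peaks_le[of n \<pi>] that by simp
    then show ?thesis by (simp add: LW_num_def)
  qed
  then show ?thesis
    by (cases "k \<le> n") (auto simp: LW_poly_def coeff_sum)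
qed

lemma LW_poly_0: "LW_poly 0 = 1"
  by (simp add: LW_poly_def LW_num_def perms_def left_peaks_def)

end

(*
  Write a permutation as a word and call a word's number of alternating runs "runs". Putting a
  virtual letter 0 (resp. infinity) at an end of a word s turns the other statistics into runs:
    as(s) = runs(0 s),
    runs(0 s infinity) = 2 (left peaks of s) + 1,
    runs(infinity s infinity) = 2 (interior peaks of s) + 2 for nonempty s.
  Runs are additive when a word is cut at its maximum m. Cutting s m t gives the first identity;
  cutting 0 s m t gives the fourth; cutting infinity s m t gives the fifth, where the empty s is the
  exceptional summand T_n and complementation shows that runs(infinity s) and runs(0 s) are
  equidistributed. The second identity is the first one for n + 1 after Pascal's rule and the
  symmetry k -> n - k. The third follows by inserting the fourth into the second, reassociating the
  trinomial convolution, and applying the first.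
*)

theory Submission
  imports Defs "HOL-Combinatorics.Multiset_Permutations" "HOL-Library.Sublist" "HOL-Library.Infinite_Set"
begin

section \<open>Statistics on words\<close>

text \<open>
  The flag \<open>d\<close> of the following functions is the direction (\<open>True\<close> for up) in which the first letter
  is entered, that is, it stands for a virtual first letter $0$ (\<open>True\<close>) or $\infty$ (\<open>False\<close>).
  So \<open>list_as True\<close> is the statistic $\mathrm{as}$, \<open>list_peaks True\<close> counts left peaks and
  \<open>list_peaks False\<close> counts interior peaks.
\<close>

fun dir_changes :: "bool \<Rightarrow> nat list \<Rightarrow> nat" where
  "dir_changes d (x # y # ys) = of_bool (d \<noteq> (x < y)) + dir_changes (x < y) (y # ys)"
| "dir_changes d _ = 0"

text \<open>There is no virtual first letter here: the first comparison opens the first run.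
  One-letter words get the value 0, which matches the convention
  \<open>R_poly 1 = 1\<close>.\<close>

fun list_runs :: "nat list \<Rightarrow> nat" where
  "list_runs (x # y # ys) = Suc (dir_changes (x < y) (y # ys))"
| "list_runs _ = 0"

definition list_as :: "bool \<Rightarrow> nat list \<Rightarrow> nat" where
  "list_as d xs = (if xs = [] then 0 else Suc (dir_changes d xs))"

fun list_peaks :: "bool \<Rightarrow> nat list \<Rightarrow> nat" where
  "list_peaks d (x # y # ys) = of_bool (d \<and> y < x) + list_peaks (x < y) (y # ys)"
| "list_peaks d _ = 0"

section \<open>Concatenation, reversal, and cutting a word at its maximum\<close>

lemma dir_changes_append:
  "dir_changes d (xs @ a # b # ys) = dir_changes d (xs @ [a, b]) + dir_changes (a < b) (b # ys)"
proof (induction d xs rule: dir_changes.induct)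
  case ("2_2" d x)
  then show ?case by simp
qed simp_all

text \<open>The two pieces overlap in the step from \<open>a\<close> to \<open>b\<close>, so each
  turn lies in exactly one of them, while the run containing that step is counted twice; hence the
  \<open>Suc\<close>.\<close>

lemma list_runs_append:
  "Suc (list_runs (xs @ a # b # ys)) = list_runs (xs @ [a, b]) + list_runs (a # b # ys)"
proof (cases xs)
  case (Cons x xs')
  then show ?thesis
    using dir_changes_append[of _ xs a b ys] by (cases xs') (auto simp: dir_changes_append)
qed simp

text \<open>Peeling off the first letter \<open>x\<close> affects only the triple \<open>x\<close>,
  \<open>y\<close>, \<open>z\<close>, and for distinct letters such a triple turns at
  \<open>y\<close> in either reading direction.\<close>

lemma list_runs_rev: "distinct xs \<Longrightarrow> list_runs (rev xs) = list_runs xs"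
proof (induction xs rule: induct_list012)
  case (3 x y zs)
  show ?case
  proof (cases zs)
    case (Cons z ws)
    have "Suc (list_runs (rev (x # y # zs))) = list_runs (rev (y # zs)) + list_runs [z, y, x]"
      using list_runs_append[of "rev ws" z y "[x]"] Cons by simp
    also have "list_runs (rev (y # zs)) = list_runs (y # zs)"
      using 3 by simp
    also have "list_runs (y # zs) + list_runs [z, y, x] = Suc (list_runs (x # y # zs))"
      using Cons 3(3) by auto
    finally show ?thesis by simp
  qed (use 3 in auto)
qed simp_all

lemma list_runs_Cons_max:
  assumes "\<forall>x\<in>set xs. x < m"
  shows "list_runs (m # xs) = list_as False xs"
  using assms by (cases xs) (auto simp: list_as_def)

text \<open>No run passes through \<open>m\<close>. Read away from \<open>m\<close>, each side
  starts below a letter that acts as infinity, so the left side appears reversed.\<close>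

lemma list_runs_split_max:
  assumes "distinct (xs @ m # ys)" "\<forall>x\<in>set (xs @ ys). x < m"
  shows "list_runs (xs @ m # ys) = list_as False (rev xs) + list_as False ys"
proof -
  have left: "list_as False (rev xs) = list_runs (xs @ [m])"
    using list_runs_Cons_max[of "rev xs" m] list_runs_rev[of "xs @ [m]"] assms by auto
  show ?thesis
  proof (cases xs rule: rev_cases)
    case Nil
    then show ?thesis
      using list_runs_Cons_max[of ys m] assms by (simp add: list_as_def)
  next
    case (snoc ws w)
    show ?thesis
    proof (cases ys)
      case Nil
      then show ?thesis using left by (simp add: list_as_def)
    next
      case (Cons z zs)
      have "Suc (list_runs (xs @ m # ys)) = list_runs (xs @ [m]) + list_runs (w # m # ys)"
        using list_runs_append[of ws w m ys] snoc by simp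
      \<comment> \<open>With letters on both sides \<open>m\<close> is a peak; the additional run
        cancels the \<open>Suc\<close> from the overlap.\<close>
      moreover have "list_runs (w # m # ys) = Suc (list_runs (m # ys))"
        using snoc Cons assms(2) by auto
      moreover have "list_runs (m # ys) = list_as False ys"
        using assms by (intro list_runs_Cons_max) auto
      ultimately show ?thesis using left by simp
    qed
  qed
qed

text \<open>Peaks and valleys alternate, and the final step up to \<open>m\<close> forces a valley
  after every peak. Entering downwards adds one valley before the first peak.\<close>

lemma dir_changes_snoc_max:
  assumes "distinct (x # xs)" "\<forall>y\<in>set (x # xs). y < m"
  shows "dir_changes d (x # xs @ [m]) = of_bool (\<not> d) + 2 * list_peaks d (x # xs)"
  using assms
proof (induction xs arbitrary: d x)
  case (Cons y ys)
  then show ?case by auto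
qed auto

text \<open>Since \<open>xs\<close> is nonempty, \<open>m\<close> is entered upwards. If
  \<open>ys\<close> is nonempty, leaving \<open>m\<close> is a change, and it supplies the
  \<open>Suc\<close> in \<open>list_as False ys\<close>.\<close>

lemma dir_changes_split_max:
  assumes "\<forall>x\<in>set (xs @ ys). x < m" "xs \<noteq> []"
  shows "dir_changes d (xs @ m # ys) = dir_changes d (xs @ [m]) + list_as False ys"
proof -
  obtain ws w where xs: "xs = ws @ [w]" using assms(2) by (cases xs rule: rev_cases) auto
  show ?thesis
    using assms dir_changes_append[of d ws w m ys]
    by (cases ys) (auto simp: xs list_as_def)
qed

lemma list_as_True_split_max:
  assumes "distinct (xs @ m # ys)" "\<forall>x\<in>set (xs @ ys). x < m"
  shows "list_as True (xs @ m # ys) = Suc (2 * list_peaks True xs) + list_as False ys"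
proof (cases xs)
  case Nil
  then show ?thesis using assms by (cases ys) (auto simp: list_as_def)
next
  case (Cons z zs)
  then show ?thesis
    using assms dir_changes_split_max[OF assms(2), of True] dir_changes_snoc_max[of z zs m True]
    by (simp add: list_as_def)
qed

text \<open>For empty \<open>xs\<close> the descent from infinity just continues through
  \<open>m\<close>, which therefore contributes nothing. Otherwise the 2 consists of the initial run
  and the extra valley. The word \<open>[m]\<close> has value 1 and does not fit the
  formula.\<close>

lemma list_as_False_split_max:
  assumes "distinct (xs @ m # ys)" "\<forall>x\<in>set (xs @ ys). x < m" "xs @ ys \<noteq> []"
  shows "list_as False (xs @ m # ys) =
    (if xs = [] then 0 else 2 + 2 * list_peaks False xs) + list_as False ys"
proof (cases xs)
  case Nil
  then show ?thesis using assms by (cases ys) (auto simp: list_as_def)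
next
  case (Cons z zs)
  then show ?thesis
    using assms dir_changes_split_max[OF assms(2), of False] dir_changes_snoc_max[of z zs m False]
    by (simp add: list_as_def)
qed

section \<open>Generating functions and cutting at the maximum\<close>

definition order_invariant :: "(nat list \<Rightarrow> nat) \<Rightarrow> bool" where
  "order_invariant f \<longleftrightarrow> (\<forall>h xs. strict_mono_on (set xs) h \<longrightarrow> f (map h xs) = f xs)"

section \<open>Behaviour under increasing and decreasing relabelling\<close>

lemma dir_changes_map_mono:
  "strict_mono_on (set xs) h \<Longrightarrow> dir_changes d (map h xs) = dir_changes d xs"
proof (induction d xs rule: dir_changes.induct)
  case (1 d x y ys)
  have "h x < h y \<longleftrightarrow> x < y"
    using 1(2) by (auto simp: strict_mono_on_less)
  moreover have "strict_mono_on (set (y # ys)) h"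
    using 1(2) by (rule monotone_on_subset) auto
  ultimately show ?case using 1(1) by simp
qed auto

lemma list_peaks_map_mono:
  "strict_mono_on (set xs) h \<Longrightarrow> list_peaks d (map h xs) = list_peaks d xs"
proof (induction d xs rule: list_peaks.induct)
  case (1 d x y ys)
  have "h x < h y \<longleftrightarrow> x < y" "h y < h x \<longleftrightarrow> y < x"
    using 1(2) by (auto simp: strict_mono_on_less)
  moreover have "strict_mono_on (set (y # ys)) h"
    using 1(2) by (rule monotone_on_subset) auto
  ultimately show ?case using 1(1) by simp
qed auto

lemma dir_changes_map_antimono:
  assumes "distinct xs" "\<And>x y. x \<in> set xs \<Longrightarrow> y \<in> set xs \<Longrightarrow> x < y \<Longrightarrow> h y < h x"
  shows "dir_changes d (map h xs) = dir_changes (\<not> d) xs"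
  using assms
proof (induction xs arbitrary: d rule: induct_list012)
  case (3 x y ys)
  have "h x < h y \<longleftrightarrow> \<not> x < y"
    using 3(3) 3(4)[of x y] 3(4)[of y x] by force
  then show ?case using 3 by simp
qed auto

lemma order_invariant_list_as: "order_invariant (list_as d)"
  by (auto simp: order_invariant_def list_as_def dir_changes_map_mono)

lemma order_invariant_list_as_rev: "order_invariant (\<lambda>xs. list_as d (rev xs))"
  using dir_changes_map_mono[of "rev _"]
  by (auto simp: order_invariant_def list_as_def simp flip: rev_map)

lemma order_invariant_list_peaks: "order_invariant (list_peaks d)"
  by (auto simp: order_invariant_def list_peaks_map_mono)

lemma order_invariant_list_runs: "order_invariant list_runs"
  unfolding order_invariant_def
proof (intro allI impI)
  fix h :: "nat \<Rightarrow> nat" and xs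
  assume h: "strict_mono_on (set xs) h"
  show "list_runs (map h xs) = list_runs xs"
  proof (cases xs rule: list_runs.cases)
    case (1 x y ys)
    then have "h x < h y \<longleftrightarrow> x < y"
      using h by (auto simp: strict_mono_on_less)
    moreover have "strict_mono_on (set (y # ys)) h"
      using h 1 by (auto intro: monotone_on_subset)
    ultimately show ?thesis
      using 1 dir_changes_map_mono[of "y # ys" h] by simp
  qed auto
qed

section \<open>Generating functions over the arrangements of a letter set\<close>

definition list_gf :: "(nat list \<Rightarrow> nat) \<Rightarrow> nat set \<Rightarrow> int poly" where
  "list_gf f A = (\<Sum>xs\<in>permutations_of_set A. monom 1 (f xs))"

lemma list_gf_bij:
  assumes "bij_betw h A B" "\<And>xs. set xs = A \<Longrightarrow> distinct xs \<Longrightarrow> f (map h xs) = g xs"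
  shows "list_gf f B = list_gf g A"
proof -
  have B: "permutations_of_set B = map h ` permutations_of_set A"
    using permutations_of_set_image_inj[of h A] assms(1) by (auto simp: bij_betw_def)
  have inj: "inj_on (map h) (permutations_of_set A)"
    using assms(1) by (auto simp: bij_betw_def permutations_of_set_def inj_on_def
        intro!: map_inj_on[of h] intro: inj_on_subset)
  show ?thesis
    unfolding list_gf_def B sum.reindex[OF inj]
    by (rule sum.cong) (auto simp: permutations_of_set_def assms(2))
qed

text \<open>The increasing enumeration of \<open>A\<close> relabels its words without changing
  \<open>f\<close>. This standardises the arbitrary letter sets that arise on cutting a
  word.\<close>

lemma list_gf_card:
  assumes "finite A" "order_invariant f"
  shows "list_gf f A = list_gf f {..<card A}"
proof -
  obtain h where h: "bij_betw h {..<card A} A" "strict_mono_on {..<card A} h"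
    using ex_bij_betw_strict_mono_card[OF assms(1)] by blast
  show ?thesis
    using h assms(2) by (intro list_gf_bij[of h]) (auto simp: order_invariant_def)
qed

lemma list_gf_rev: "list_gf (\<lambda>xs. f (rev xs)) A = list_gf f A"
  unfolding list_gf_def
  by (rule sum.reindex_bij_witness[of _ rev rev]) (auto simp: permutations_of_set_def)

text \<open>Complementing the letters exchanges ascents with descents, and the virtual first letter
  0 with infinity.\<close>

lemma list_gf_as_complement: "list_gf (list_as d) {..<n} = list_gf (list_as (\<not> d)) {..<n}"
proof (rule list_gf_bij[of "\<lambda>x. n - Suc x"])
  show "bij_betw (\<lambda>x. n - Suc x) {..<n} {..<n}"
    by (rule bij_betwI[of _ _ _ "\<lambda>x. n - Suc x"]) auto
  show "list_as d (map (\<lambda>x. n - Suc x) xs) = list_as (\<not> d) xs"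
    if "set xs = {..<n}" "distinct xs" for xs
    using that dir_changes_map_antimono[of xs "\<lambda>x. n - Suc x" d] by (auto simp: list_as_def)
qed

section \<open>Sums over words cut at a letter\<close>

lemma sum_Pow_card:
  fixes f :: "nat \<Rightarrow> 'a::comm_semiring_1"
  assumes "finite A"
  shows "(\<Sum>B\<in>Pow A. f (card B)) = (\<Sum>k=0..card A. of_nat (card A choose k) * f k)"
proof -
  have "(\<Sum>B\<in>Pow A. f (card B)) = (\<Sum>k=0..card A. \<Sum>B\<in>{B\<in>Pow A. card B = k}. f (card B))"
    using assms by (intro sum.group[symmetric]) (auto intro: card_mono)
  also have "\<dots> = (\<Sum>k=0..card A. of_nat (card A choose k) * f k)"
    using assms by (intro sum.cong) (auto simp: n_subsets)
  finally show ?thesis .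
qed

lemma sum_permutations_of_set_split:
  assumes "finite A" "m \<in> A"
  shows "(\<Sum>xs\<in>permutations_of_set A. F xs) =
    (\<Sum>B\<in>Pow (A - {m}). \<Sum>ys\<in>permutations_of_set B. \<Sum>xs\<in>permutations_of_set (A - {m} - B).
      F (xs @ m # ys))"
proof -
  have "(\<Sum>B\<in>Pow (A - {m}). \<Sum>ys\<in>permutations_of_set B. \<Sum>xs\<in>permutations_of_set (A - {m} - B).
      F (xs @ m # ys)) =
    (\<Sum>(B, ys, xs)\<in>(SIGMA B:Pow (A - {m}). permutations_of_set B \<times> permutations_of_set (A - {m} - B)).
      F (xs @ m # ys))"
    using assms(1)
    by (subst sum.Sigma[symmetric]) (auto simp: sum.cartesian_product)
  also have "\<dots> = (\<Sum>xs\<in>permutations_of_set A. F xs)"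
  \<comment> \<open>Distinctness makes the first occurrence of \<open>m\<close> the only one, so
    \<open>takeWhile\<close> and \<open>dropWhile\<close> recover both sides; \<open>B\<close> is
    the set of letters to the right of \<open>m\<close>.\<close>
  proof (rule sum.reindex_bij_witness[of _
      "\<lambda>zs. (set (tl (dropWhile (\<lambda>x. x \<noteq> m) zs)), tl (dropWhile (\<lambda>x. x \<noteq> m) zs), takeWhile (\<lambda>x. x \<noteq> m) zs)"
      "\<lambda>(B, ys, xs). xs @ m # ys"], goal_cases)
    case (1 a)
    then show ?case
      by (auto simp: permutations_of_set_def takeWhile_append dropWhile_append)
  next
    case (2 a)
    then show ?case
      using assms by (auto simp: permutations_of_set_def)
  next
    case (3 zs)
    then obtain xs ys where "zs = xs @ m # ys"
      using assms(2) by (metis permutations_of_setD(1) split_list)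
    moreover from this have "m \<notin> set xs"
      using 3 by (auto simp: permutations_of_set_def)
    ultimately show ?case by (auto simp: takeWhile_append dropWhile_append)
  next
    case (4 zs)
    then obtain xs ys where "zs = xs @ m # ys"
      using assms(2) by (metis permutations_of_setD(1) split_list)
    moreover from this have "m \<notin> set xs"
      using 4 by (auto simp: permutations_of_set_def)
    ultimately show ?case
      using 4 by (auto simp: permutations_of_set_def takeWhile_append dropWhile_append)
  qed auto
  finally show ?thesis ..
qed

text \<open>The index \<open>k\<close> counts the letters to the right of the maximum
  \<open>n\<close>, and the binomial coefficient counts the choices of these letters. The two sides
  are then arranged independently, so additive statistics give products.\<close>

lemma list_gf_split_max:
  assumes "order_invariant g" "order_invariant h"
    and fgh: "\<And>xs ys. distinct (xs @ n # ys) \<Longrightarrow> set (xs @ ys) = {..<n} \<Longrightarrow>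
      f (xs @ n # ys) = g xs + h ys"
  shows "list_gf f {..<Suc n} =
    (\<Sum>k=0..n. of_nat (n choose k) * list_gf h {..<k} * list_gf g {..<n - k})"
proof -
  have A: "{..<Suc n} - {n} = {..<n}" by auto
  have "list_gf f {..<Suc n} = (\<Sum>B\<in>Pow {..<n}. \<Sum>ys\<in>permutations_of_set B.
      \<Sum>xs\<in>permutations_of_set ({..<n} - B). monom 1 (f (xs @ n # ys)))"
    unfolding list_gf_def by (subst sum_permutations_of_set_split[of _ n]) (auto simp: A)
  also have "\<dots> = (\<Sum>B\<in>Pow {..<n}. \<Sum>ys\<in>permutations_of_set B.
      \<Sum>xs\<in>permutations_of_set ({..<n} - B). monom 1 (h ys) * monom 1 (g xs))"
  proof (intro sum.cong refl)
    fix B ys xs assume "B \<in> Pow {..<n}" "ys \<in> permutations_of_set B"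
      "xs \<in> permutations_of_set ({..<n} - B)"
    then have "f (xs @ n # ys) = g xs + h ys"
      by (intro fgh) (auto simp: permutations_of_set_def)
    then show "monom (1::int) (f (xs @ n # ys)) = monom 1 (h ys) * monom 1 (g xs)"
      by (simp add: mult_monom add.commute)
  qed
  also have "\<dots> = (\<Sum>B\<in>Pow {..<n}. list_gf h B * list_gf g ({..<n} - B))"
    by (simp add: list_gf_def sum_product)
  also have "\<dots> = (\<Sum>B\<in>Pow {..<n}. list_gf h {..<card B} * list_gf g {..<n - card B})"
  proof (intro sum.cong refl)
    fix B assume B: "B \<in> Pow {..<n}"
    then have fin: "finite B" by (auto intro: finite_subset)
    have "list_gf h B = list_gf h {..<card B}"
      using fin assms by (intro list_gf_card)
    moreover have "list_gf g ({..<n} - B) = list_gf g {..<n - card B}"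
      using list_gf_card[of "{..<n} - B" g] assms(1) B fin by (simp add: card_Diff_subset)
    ultimately show "list_gf h B * list_gf g ({..<n} - B)
        = list_gf h {..<card B} * list_gf g {..<n - card B}" by simp
  qed
  also have "\<dots> = (\<Sum>k=0..n. of_nat (n choose k) * (list_gf h {..<k} * list_gf g {..<n - k}))"
    using sum_Pow_card[of "{..<n}" "\<lambda>k. list_gf h {..<k} * list_gf g {..<n - k}"] by simp
  finally show ?thesis by (simp add: mult.assoc)
qed


section \<open>From permutations to words\<close>

text \<open>A common form for turns and peaks, linking the index sets of the original definitions to
  the recursive word statistics.\<close>

definition count_triples :: "(nat \<Rightarrow> nat \<Rightarrow> nat \<Rightarrow> bool) \<Rightarrow> nat list \<Rightarrow> nat" where
  "count_triples Q xs = card {i. i + 2 < length xs \<and> Q (xs ! i) (xs ! (i + 1)) (xs ! (i + 2))}"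

lemma count_triples_short: "length xs \<le> 2 \<Longrightarrow> count_triples Q xs = 0"
  by (auto simp: count_triples_def)

lemma count_triples_Cons:
  "count_triples Q (a # b # c # xs) = of_bool (Q a b c) + count_triples Q (b # c # xs)"
proof -
  let ?S = "\<lambda>xs. {i. i + 2 < length xs \<and> Q (xs ! i) (xs ! (i + 1)) (xs ! (i + 2))}"
  have fin: "finite (?S xs)" for xs
    by (rule finite_subset[of _ "{..<length xs}"]) auto
  have "?S (a # b # c # xs) = (if Q a b c then {0} else {}) \<union> Suc ` ?S (b # c # xs)"
  proof (rule set_eqI)
    fix i show "i \<in> ?S (a # b # c # xs) \<longleftrightarrow>
      i \<in> (if Q a b c then {0} else {}) \<union> Suc ` ?S (b # c # xs)"
      by (cases i) (auto simp: numeral_2_eq_2)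
  qed
  then have "card (?S (a # b # c # xs)) = card (if Q a b c then {0::nat} else {}) + card (Suc ` ?S (b # c # xs))"
    using fin[of "b # c # xs"] by (simp only:) (subst card_Un_disjoint, auto)
  then show ?thesis
    by (simp only: count_triples_def card_image[OF inj_Suc[THEN inj_on_subset, OF subset_UNIV]]) simp
qed

text \<open>On the left \<open>i\<close> is the index of the middle letter of a triple; on the right
  the triple is located by the list position \<open>i - Suc s\<close> of its first letter.\<close>

lemma count_triples_map_upt:
  "card {i \<in> {Suc s..<e - 1}. Q (\<pi> (i - 1)) (\<pi> i) (\<pi> (i + 1))} = count_triples Q (map \<pi> [s..<e])"
  unfolding count_triples_def
proof (rule bij_betw_same_card[of "\<lambda>i. i - Suc s"], rule bij_betwI[of _ _ _ "\<lambda>i. i + Suc s"], goal_cases)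
  case 1
  then show ?case
  proof (intro Pi_I)
    fix i assume "i \<in> {i \<in> {Suc s..<e - 1}. Q (\<pi> (i - 1)) (\<pi> i) (\<pi> (i + 1))}"
    moreover from this obtain j where "i = Suc s + j"
      using le_Suc_ex[of "Suc s" i] by auto
    ultimately show "i - Suc s \<in> {i. i + 2 < length (map \<pi> [s..<e]) \<and>
        Q (map \<pi> [s..<e] ! i) (map \<pi> [s..<e] ! (i + 1)) (map \<pi> [s..<e] ! (i + 2))}"
      by (auto simp: algebra_simps)
  qed
qed (auto simp: algebra_simps)

lemma dir_changes_eq_count_triples:
  assumes "distinct (x # y # xs)"
  shows "dir_changes (x < y) (y # xs) =
    count_triples (\<lambda>a b c. (a < b \<and> b > c) \<or> (a > b \<and> b < c)) (x # y # xs)"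
  using assms
proof (induction xs arbitrary: x y)
  case (Cons z zs)
  have "(x < y) \<noteq> (y < z) \<longleftrightarrow> (x < y \<and> y > z) \<or> (x > y \<and> y < z)"
    using Cons(2) by auto
  then show ?case using Cons by (simp add: count_triples_Cons)
qed (simp add: count_triples_short)

lemma list_peaks_eq_count_triples:
  "list_peaks (x < y) (y # xs) = count_triples (\<lambda>a b c. a < b \<and> b > c) (x # y # xs)"
  by (induction xs arbitrary: x y) (simp_all add: count_triples_short count_triples_Cons)

lemma list_peaks_False_eq_count_triples:
  "list_peaks False xs = count_triples (\<lambda>a b c. a < b \<and> b > c) xs"
  by (cases "(False, xs)" rule: list_peaks.cases)
    (auto simp: count_triples_short list_peaks_eq_count_triples)

section \<open>Permutations as words\<close>

lemma perms_map_upt_permutations: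
  assumes "\<pi> \<in> perms n"
  shows "map \<pi> [1..<Suc n] \<in> permutations_of_set {1..n}"
proof -
  have "\<pi> permutes {1..n}" using assms by (simp add: perms_def)
  then have "inj_on \<pi> {1..n}" "\<pi> ` {1..n} = {1..n}"
    by (auto simp: permutes_inj_on permutes_image)
  moreover have "set [1..<Suc n] = {1..n}" by auto
  ultimately show ?thesis
    by (intro permutations_of_setI) (simp_all only: set_map distinct_map distinct_upt)
qed

text \<open>Injectivity holds because permutations fix every point outside \<open>{1..n}\<close>;
  surjectivity then follows by counting, both sides having \<open>fact n\<close> elements.\<close>

lemma bij_betw_perms_permutations:
  "bij_betw (\<lambda>\<pi>. map \<pi> [1..<Suc n]) (perms n) (permutations_of_set {1..n})"
proof -
  have inj: "inj_on (\<lambda>\<pi>. map \<pi> [1..<Suc n]) (perms n)"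
  proof (rule inj_onI, rule ext)
    fix \<pi> \<rho> x
    assume "\<pi> \<in> perms n" "\<rho> \<in> perms n" and eq: "map \<pi> [1..<Suc n] = map \<rho> [1..<Suc n]"
    then have "\<pi> x = x \<and> \<rho> x = x" if "x \<notin> {1..n}"
      using that by (auto simp: perms_def permutes_def)
    moreover have "\<pi> x = \<rho> x" if "x \<in> {1..n}"
      using eq that unfolding map_eq_conv by (metis atLeastAtMost_upt)
    ultimately show "\<pi> x = \<rho> x" by metis
  qed
  have "card (perms n) = fact n"
    unfolding perms_def by (rule card_permutations) auto
  then have "card ((\<lambda>\<pi>. map \<pi> [1..<Suc n]) ` perms n) = card (permutations_of_set {1..n})"
    by (simp only: card_image[OF inj]) simp
  moreover have "(\<lambda>\<pi>. map \<pi> [1..<Suc n]) ` perms n \<subseteq> permutations_of_set {1..n}"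
    using perms_map_upt_permutations by blast
  ultimately have "(\<lambda>\<pi>. map \<pi> [1..<Suc n]) ` perms n = permutations_of_set {1..n}"
    by (intro card_subset_eq) auto
  with inj show ?thesis by (simp add: bij_betw_def)
qed

lemma finite_perms: "finite (perms n)"
  by (simp add: perms_def finite_permutations)

text \<open>Grouping by the value of \<open>f\<close> turns a polynomial given by its coefficients
  into a sum over objects, provided that the range \<open>K\<close> of exponents contains all
  values.\<close>

lemma sum_monom_card_fibres:
  assumes "finite S" "finite K" "f ` S \<subseteq> K"
  shows "(\<Sum>k\<in>K. monom (int (card {x \<in> S. f x = k})) k) = (\<Sum>x\<in>S. monom 1 (f x))"
proof -
  have "(\<Sum>x\<in>S. monom (1::int) (f x)) = (\<Sum>k\<in>K. \<Sum>x\<in>{x \<in> S. f x = k}. monom 1 (f x))"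
    using assms by (intro sum.group[symmetric])
  also have "\<dots> = (\<Sum>k\<in>K. monom (int (card {x \<in> S. f x = k})) k)"
    by (intro sum.cong) (auto simp: of_nat_monom mult_monom)
  finally show ?thesis ..
qed

lemma sum_monom_perms_eq_list_gf:
  assumes "order_invariant g" "\<And>\<pi>. \<pi> \<in> perms n \<Longrightarrow> f \<pi> = g (map \<pi> [1..<Suc n])"
  shows "(\<Sum>\<pi>\<in>perms n. monom 1 (f \<pi>)) = list_gf g {..<n}"
proof -
  have "(\<Sum>\<pi>\<in>perms n. monom (1::int) (f \<pi>)) = (\<Sum>\<pi>\<in>perms n. monom 1 (g (map \<pi> [1..<Suc n])))"
    using assms(2) by (intro sum.cong) auto
  also have "\<dots> = list_gf g {1..n}"
    unfolding list_gf_def by (rule sum.reindex_bij_betw[OF bij_betw_perms_permutations])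
  finally show ?thesis
    using list_gf_card[of "{1..n}" g] assms(1) by simp
qed

section \<open>Longest alternating subsequences\<close>

fun alternates :: "bool \<Rightarrow> nat list \<Rightarrow> bool" where
  "alternates d (x # y # ys) \<longleftrightarrow> (if d then y < x else x < y) \<and> alternates (\<not> d) (y # ys)"
| "alternates d _ \<longleftrightarrow> True"

text \<open>As for \<open>list_as\<close>, the flag is the direction in which the first letter is
  entered: after entering upwards, a descent must follow.\<close>

lemma alternates_iff_nth:
  "alternates d xs \<longleftrightarrow> (\<forall>j. j + 1 < length xs \<longrightarrow>
    (if even j = d then xs ! j > xs ! (j + 1) else xs ! j < xs ! (j + 1)))"
proof (induction d xs rule: alternates.induct)
  case (1 d x y ys)
  have all_nat: "(\<forall>j. P j) \<longleftrightarrow> P 0 \<and> (\<forall>j. P (Suc j))" for P :: "nat \<Rightarrow> bool"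
    by (metis not0_implies_Suc)
  show ?case
    by (subst all_nat) (auto simp: 1)
qed auto

lemma alternating_iff: "alternating xs \<longleftrightarrow> alternates True xs"
  by (simp add: alternating_def alternates_iff_nth)

lemma dir_changes_le: "dir_changes d xs \<le> of_bool (d \<noteq> e) + dir_changes e xs"
  by (cases "(d, xs)" rule: dir_changes.cases) auto

text \<open>Induction on the word. If \<open>ys\<close> avoids the first letter \<open>x\<close>,
  then \<open>dir_changes_le\<close> suffices. If \<open>ys\<close> starts with \<open>x\<close> and
  the step from \<open>x\<close> to \<open>z\<close> is a change, that change pays for
  \<open>x\<close>; otherwise \<open>x\<close> is exchanged for \<open>z\<close>.\<close>

lemma alternates_length_le:
  assumes "distinct xs" "subseq ys xs" "alternates d ys"
  shows "length ys \<le> list_as d xs"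
  using assms
proof (induction xs arbitrary: ys d rule: induct_list012)
  case 1
  then have "length ys \<le> length ([] :: nat list)" by (blast dest: list_emb_length)
  then show ?case by simp
next
  case (2 x)
  then have "length ys \<le> length [x]" by (blast dest: list_emb_length)
  then show ?case by (simp add: list_as_def)
next
  case (3 x z zs)
  have IH: "length ys \<le> Suc (dir_changes d (z # zs))"
    if "subseq ys (z # zs)" "alternates d ys" for ys d
    using 3(2)[of ys d] 3(3) that by (simp add: list_as_def)
  show ?case
  proof (cases "subseq ys (z # zs)")
    case True
    then have "length ys \<le> Suc (dir_changes d (z # zs))"
      using IH 3 by blast
    also have "\<dots> \<le> list_as d (x # z # zs)"
      using dir_changes_le[of d "z # zs" "x < z"] by (simp add: list_as_def)
    finally show ?thesis .
  next
    case False
    then obtain ys' where ys: "ys = x # ys'" and ys': "subseq ys' (z # zs)"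
      using 3(4) by (cases ys) (auto split: if_splits)
    show ?thesis
    proof (cases ys')
      case Nil
      then show ?thesis using ys by (simp add: list_as_def)
    next
      case (Cons y ws)
      have alt: "alternates (\<not> d) ys'" "if d then y < x else x < y"
        using 3(5) ys Cons by auto
      show ?thesis
      proof (cases "d = (x < z)")
        case False
        then show ?thesis
          using IH[OF ys' alt(1)] ys by (cases d) (auto simp: list_as_def)
      next
        case True
        \<comment> \<open>The letter \<open>z\<close> is more extreme than \<open>x\<close> and can replace it.\<close>
        then have "y \<noteq> z" using alt(2) 3(3) by (cases d) auto
        then have "subseq ys' zs" using ys' Cons by simp
        moreover have "alternates d (z # ys')"
          using alt True 3(3) Cons by (cases d) auto
        ultimately have "length (z # ys') \<le> Suc (dir_changes d (z # zs))"
          by (intro IH) auto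
        then show ?thesis using True ys by (simp add: list_as_def)
      qed
    qed
  qed
qed

text \<open>The bound on the first letter makes the induction work: it allows \<open>x\<close> to be prepended.\<close>

lemma ex_alternates_length:
  assumes "distinct (x # xs)"
  shows "\<exists>y ys. subseq (y # ys) (x # xs) \<and> alternates d (y # ys) \<and>
    length (y # ys) = Suc (dir_changes d (x # xs)) \<and> (if d then x \<le> y else y \<le> x)"
  using assms
proof (induction xs arbitrary: x d)
  case Nil
  show ?case by (intro exI[of _ x] exI[of _ "[]"]) auto
next
  case (Cons z zs)
  obtain y ys where y: "subseq (y # ys) (z # zs)" "alternates (x < z) (y # ys)"
    "length (y # ys) = Suc (dir_changes (x < z) (z # zs))" "if x < z then z \<le> y else y \<le> z"
    using Cons.IH[of z "x < z"] Cons(2) by auto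
  show ?case
  proof (cases "d = (x < z)")
    \<comment> \<open>No change at \<open>x\<close>: the subsequence found in the tail serves, and
      its bound relative to \<open>z\<close> carries over to \<open>x\<close>.\<close>
    case True
    then show ?thesis
      using y Cons(2) by (intro exI[of _ y] exI[of _ ys]) (auto split: if_splits)
  next
    \<comment> \<open>Here \<open>z\<close> lies on the side of \<open>x\<close> required by the
      next alternation, and \<open>y\<close> lies at least as far out, so \<open>x\<close> can be
      put in front.\<close>
    case False
    then show ?thesis
      using y Cons(2) by (intro exI[of _ x] exI[of _ "y # ys"]) (auto split: if_splits)
  qed
qed

text \<open>Increasing index lists are the subsequences of \<open>[1..<Suc n]\<close>, and their
  images are the subsequences of the word. The upper bound and the explicit witness then determine
  the maximum.\<close>

lemma longest_alt_eq:
  assumes "\<pi> \<in> perms n"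
  shows "longest_alt n \<pi> = list_as True (map \<pi> [1..<Suc n])"
proof -
  let ?w = "map \<pi> [1..<Suc n]"
  have dist: "distinct ?w"
    using perms_map_upt_permutations[OF assms] by (simp only: permutations_of_setD)
  have upt: "sorted_wrt (<) js \<and> set js \<subseteq> {1..n} \<longleftrightarrow> subseq js [1..<Suc n]" for js
  proof
    assume "sorted_wrt (<) js \<and> set js \<subseteq> {1..n}"
    then show "subseq js [1..<Suc n]"
      by (intro sorted_subset_imp_subseq) (auto simp: sorted_wrt_upt simp del: upt_Suc)
  next
    assume "subseq js [1..<Suc n]"
    then obtain N where "js = nths [1..<Suc n] N" by (auto simp: subseq_conv_nths)
    then show "sorted_wrt (<) js \<and> set js \<subseteq> {1..n}"
      using set_nths_subset[of "[1..<Suc n]" N] sorted_nths[of "[1..<Suc n]" N]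
        distinct_nthsI[of "[1..<Suc n]" N]
      by (auto simp: strict_sorted_iff simp del: upt_Suc)
  qed
  have "{length js | js. sorted_wrt (<) js \<and> set js \<subseteq> {1..n} \<and> alternating (map \<pi> js)} =
    {length ys | ys. subseq ys ?w \<and> alternates True ys}" (is "?L = ?R")
  proof (intro equalityI subsetI)
    fix l assume "l \<in> ?L"
    then obtain js where "l = length (map \<pi> js)" "subseq js [1..<Suc n]" "alternates True (map \<pi> js)"
      using upt alternating_iff by auto
    then show "l \<in> ?R" using subseq_map by blast
  next
    fix l assume "l \<in> ?R"
    then obtain ys where "l = length ys" "subseq ys ?w" "alternates True ys" by auto
    moreover from this obtain N where "ys = map \<pi> (nths [1..<Suc n] N)"
      by (auto simp: subseq_conv_nths nths_map simp del: upt_Suc)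
    moreover have "subseq (nths [1..<Suc n] N) [1..<Suc n]"
      by (auto simp: subseq_conv_nths)
    ultimately show "l \<in> ?L" using upt alternating_iff by (auto simp del: upt_Suc)
  qed
  moreover have "Max ?R = list_as True ?w"
  proof (rule Max_eqI)
    show "finite ?R"
      using alternates_length_le[OF dist] by (intro finite_subset[of ?R "{..list_as True ?w}"]) auto
    show "l \<le> list_as True ?w" if "l \<in> ?R" for l
      using that alternates_length_le[OF dist] by auto
    show "list_as True ?w \<in> ?R"
    proof (cases ?w)
      case Nil
      then show ?thesis by (auto simp: list_as_def simp del: upt_Suc)
    next
      case (Cons x xs)
      then have "distinct (x # xs)" using dist by simp
      then obtain ys where "subseq ys (x # xs)" "alternates True ys" "length ys = Suc (dir_changes True (x # xs))"
        using ex_alternates_length[of x xs True] by blast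
      then show ?thesis unfolding Cons by (intro CollectI exI[of _ ys]) (simp add: list_as_def)
    qed
  qed
  ultimately show ?thesis by (simp add: longest_alt_def)
qed

section \<open>The given polynomials as generating functions of words\<close>

lemma dir_changes_le_length: "dir_changes d xs \<le> length xs - Suc 0"
  by (induction d xs rule: dir_changes.induct) (auto simp: of_bool_def)

lemma T_poly_eq: "T_poly n = list_gf (list_as True) {..<n}"
proof (cases "n = 0")
  case False
  have "longest_alt n \<pi> \<in> {1..n}" if "\<pi> \<in> perms n" for \<pi>
    using longest_alt_eq[OF that] dir_changes_le_length[of True "map \<pi> [1..<Suc n]"] False
    by (auto simp: list_as_def simp del: upt_Suc)
  then have "T_poly n = (\<Sum>\<pi>\<in>perms n. monom 1 (longest_alt n \<pi>))"
    unfolding T_poly_def a_num_def using False finite_perms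
    by (subst sum_monom_card_fibres) auto
  then show ?thesis
    using sum_monom_perms_eq_list_gf[OF order_invariant_list_as longest_alt_eq] by simp
qed (simp add: T_poly_def list_gf_def list_as_def)

text \<open>This is the form met after cutting, where the removed maximum acts as infinity.\<close>

lemma T_poly_eq_False: "T_poly n = list_gf (list_as False) {..<n}"
  using list_gf_as_complement[of False n] by (simp add: T_poly_eq)

lemma alt_runs_eq:
  assumes "\<pi> \<in> perms n" "n \<ge> 2"
  shows "alt_runs n \<pi> = list_runs (map \<pi> [1..<Suc n])"
proof -
  have "distinct (map \<pi> [1..<Suc n])"
    using perms_map_upt_permutations[OF assms(1)] by (simp only: permutations_of_setD)
  moreover obtain x y xs where w: "map \<pi> [1..<Suc n] = x # y # xs"
    using assms(2) by (cases "map \<pi> [1..<Suc n]" rule: list_runs.cases)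
      (auto simp del: upt_Suc dest: arg_cong[of _ _ length])
  ultimately have "list_runs (map \<pi> [1..<Suc n]) =
    Suc (count_triples (\<lambda>a b c. (a < b \<and> b > c) \<or> (a > b \<and> b < c)) (map \<pi> [1..<Suc n]))"
    using dir_changes_eq_count_triples[of x y xs] by simp
  moreover have "{2..n - 1} = {Suc 1..<Suc n - 1}" using assms(2) by auto
  ultimately show ?thesis
    unfolding alt_runs_def changes_direction_at_def count_triples_map_upt[symmetric] by simp
qed

lemma list_runs_le_length: "list_runs xs \<le> length xs - 1"
proof (cases xs rule: list_runs.cases)
  case (1 x y ys)
  then show ?thesis using dir_changes_le_length[of "x < y" "y # ys"] by simp
qed auto

lemma R_poly_eq:
  assumes "n \<ge> 1"
  shows "R_poly n = list_gf list_runs {..<n}"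
proof (cases "n = 1")
  case True
  have "{..<Suc 0} = {0}" by auto
  then show ?thesis using True by (simp add: R_poly_def list_gf_def)
next
  case False
  then have n: "n \<ge> 2" using assms by simp
  have "alt_runs n \<pi> \<in> {1..n - 1}" if "\<pi> \<in> perms n" for \<pi>
    using alt_runs_eq[OF that n] list_runs_le_length[of "map \<pi> [1..<Suc n]"]
    by (auto simp: alt_runs_def simp del: upt_Suc)
  then have "R_poly n = (\<Sum>\<pi>\<in>perms n. monom 1 (alt_runs n \<pi>))"
    unfolding R_poly_def R_num_def using False finite_perms
    by (subst sum_monom_card_fibres) auto
  then show ?thesis
    using sum_monom_perms_eq_list_gf[OF order_invariant_list_runs alt_runs_eq[OF _ n]] by simp
qed

lemma card_interior_peaks_eq:
  "card (interior_peaks n \<pi>) = list_peaks False (map \<pi> [1..<Suc n])"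
proof -
  have "{2..n - 1} = {Suc 1..<Suc n - 1}" by auto
  then show ?thesis
    unfolding interior_peaks_def list_peaks_False_eq_count_triples count_triples_map_upt[symmetric]
    by simp
qed

lemma card_left_peaks_eq:
  assumes "\<pi> \<in> perms n"
  shows "card (left_peaks n \<pi>) = list_peaks True (map \<pi> [1..<Suc n])"
proof -
  have "\<pi> 0 = 0" using assms by (auto simp: perms_def permutes_def)
  \<comment> \<open>The value at index 0 realises the virtual letter 0; it lies below the first
    letter, so the flag becomes \<open>True\<close>.\<close>
  then have w: "map \<pi> [0..<Suc n] = 0 # map \<pi> [1..<Suc n]"
    by (simp add: upt_conv_Cons del: upt_Suc)
  have "{1..n - 1} = {Suc 0..<Suc n - 1}" by auto
  then have "card (left_peaks n \<pi>) =
    count_triples (\<lambda>a b c. a < b \<and> b > c) (0 # map \<pi> [1..<Suc n])"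
    unfolding left_peaks_def w[symmetric] count_triples_map_upt[symmetric] by simp
  also have "\<dots> = list_peaks True (map \<pi> [1..<Suc n])"
  proof (cases "map \<pi> [1..<Suc n]")
    case Nil
    then show ?thesis by (simp add: count_triples_short del: upt_Suc)
  next
    case (Cons x xs)
    then have "x \<in> set (map \<pi> [1..<Suc n])" by simp
    then have "x > 0"
      using permutations_of_setD(1)[OF perms_map_upt_permutations[OF assms]] by simp
    then show ?thesis
      unfolding Cons using list_peaks_eq_count_triples[of 0 x xs] by simp
  qed
  finally show ?thesis .
qed

lemma pcompose_monom_2: "pcompose (monom 1 k) (monom 1 2) = (monom 1 (2 * k) :: int poly)"
  by (induction k) (auto simp: pcompose_mult monom_Suc pcompose_pCons pcompose_1 mult_monom)

lemma W_poly_pcompose_eq: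
  "pcompose (W_poly n) (monom 1 2) = list_gf (\<lambda>xs. 2 * list_peaks False xs) {..<n}"
proof -
  have "W_poly n = (\<Sum>\<pi>\<in>perms n. monom 1 (card (interior_peaks n \<pi>)))"
    unfolding W_poly_def W_num_def using card_interior_peaks_le finite_perms
    by (subst sum_monom_card_fibres) auto
  then have "pcompose (W_poly n) (monom 1 2) =
    (\<Sum>\<pi>\<in>perms n. monom 1 (2 * card (interior_peaks n \<pi>)))"
    by (simp add: pcompose_sum pcompose_monom_2)
  then show ?thesis
    using sum_monom_perms_eq_list_gf[of "\<lambda>xs. 2 * list_peaks False xs" n
        "\<lambda>\<pi>. 2 * card (interior_peaks n \<pi>)"] order_invariant_list_peaks[of False]
      card_interior_peaks_eq by (auto simp: order_invariant_def)
qed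

lemma LW_poly_pcompose_eq:
  "pcompose (LW_poly n) (monom 1 2) = list_gf (\<lambda>xs. 2 * list_peaks True xs) {..<n}"
proof -
  have "LW_poly n = (\<Sum>\<pi>\<in>perms n. monom 1 (card (left_peaks n \<pi>)))"
    unfolding LW_poly_def LW_num_def using card_left_peaks_le finite_perms
    by (subst sum_monom_card_fibres) auto
  then have "pcompose (LW_poly n) (monom 1 2) =
    (\<Sum>\<pi>\<in>perms n. monom 1 (2 * card (left_peaks n \<pi>)))"
    by (simp add: pcompose_sum pcompose_monom_2)
  then show ?thesis
    using sum_monom_perms_eq_list_gf[of "\<lambda>xs. 2 * list_peaks True xs" n
        "\<lambda>\<pi>. 2 * card (left_peaks n \<pi>)"] order_invariant_list_peaks[of True]
      card_left_peaks_eq by (auto simp: order_invariant_def)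
qed

section \<open>The convolution identities\<close>

lemma list_gf_add_const: "list_gf (\<lambda>xs. c + f xs) A = monom 1 c * list_gf f A"
  by (simp add: list_gf_def sum_distrib_left mult_monom)

text \<open>Reversal permutes the words to the left of the maximum, so both sides contribute the
  same kind of factor.\<close>

lemma R_poly_Suc: "R_poly (n + 1) = (\<Sum>k = 0..n. of_nat (n choose k) * T_poly k * T_poly (n - k))"
proof -
  have "list_gf list_runs {..<Suc n} = (\<Sum>k=0..n. of_nat (n choose k) *
      list_gf (list_as False) {..<k} * list_gf (\<lambda>xs. list_as False (rev xs)) {..<n - k})"
    by (intro list_gf_split_max order_invariant_list_as order_invariant_list_as_rev list_runs_split_max) auto
  then show ?thesis
    by (simp add: R_poly_eq T_poly_eq_False list_gf_rev[of "list_as False"])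
qed

lemma T_poly_Suc_left:
  "T_poly (n + 1) = monom 1 1 *
    (\<Sum>k = 0..n. of_nat (n choose k) * T_poly k * pcompose (LW_poly (n - k)) (monom 1 2))"
proof -
  have inv: "order_invariant (\<lambda>xs. 1 + 2 * list_peaks True xs)"
    using order_invariant_list_peaks[of True] by (simp add: order_invariant_def)
  have "list_gf (list_as True) {..<Suc n} = (\<Sum>k=0..n. of_nat (n choose k) *
      list_gf (list_as False) {..<k} * list_gf (\<lambda>xs. 1 + 2 * list_peaks True xs) {..<n - k})"
    using list_as_True_split_max by (intro list_gf_split_max order_invariant_list_as inv) auto
  then show ?thesis
    unfolding list_gf_add_const
    by (simp add: T_poly_eq[of "Suc n"] T_poly_eq_False[symmetric] LW_poly_pcompose_eq sum_distrib_left mult_ac)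
qed

lemma T_poly_Suc_interior:
  assumes "n \<ge> 1"
  shows "T_poly (n + 1) = T_poly n + monom 1 2 *
    (\<Sum>k = 0..n - 1. of_nat (n choose k) * T_poly k * pcompose (W_poly (n - k)) (monom 1 2))"
proof -
  \<comment> \<open>The contribution of the part left of the maximum; the constant 2 becomes the
    factor \<open>monom 1 2\<close>.\<close>
  let ?g = "\<lambda>xs. if xs = [] then 0 else 2 + 2 * list_peaks False xs"
  have inv: "order_invariant ?g"
    using order_invariant_list_peaks[of False] by (simp add: order_invariant_def)
  have nonempty: "xs \<noteq> []" if "set xs = {..<k}" "k > 0" for xs and k :: nat
    using that by (metis empty_iff empty_set lessThan_iff)
  have g0: "list_gf ?g {..<0} = 1"
    by (simp add: list_gf_def)
  have g: "list_gf ?g {..<k} = monom 1 2 * pcompose (W_poly k) (monom 1 2)" if "k > 0" for k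
  proof -
    have "list_gf ?g {..<k} = list_gf (\<lambda>xs. 2 + 2 * list_peaks False xs) {..<k}"
      unfolding list_gf_def using that nonempty by (intro sum.cong refl) (simp add: permutations_of_set_def)
    then show ?thesis unfolding list_gf_add_const W_poly_pcompose_eq .
  qed
  have "list_gf (list_as False) {..<Suc n} = (\<Sum>k=0..n. of_nat (n choose k) *
      list_gf (list_as False) {..<k} * list_gf ?g {..<n - k})"
  proof (intro list_gf_split_max order_invariant_list_as inv)
    fix xs ys assume "distinct (xs @ n # ys)" and xy: "set (xs @ ys) = {..<n}"
    moreover have "xs @ ys \<noteq> []" using xy assms by (intro nonempty[of _ n]) auto
    ultimately show "list_as False (xs @ n # ys) = ?g xs + list_as False ys"
      by (intro list_as_False_split_max) auto
  qed
  \<comment> \<open>The summand \<open>k = n\<close>, where nothing stands left of the maximum, is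
    split off and equals \<open>T_poly n\<close>.\<close>
  also have "\<dots> = (\<Sum>k=0..n - 1. of_nat (n choose k) *
      list_gf (list_as False) {..<k} * list_gf ?g {..<n - k}) + T_poly n"
  proof -
    obtain m where n: "n = Suc m" using assms by (cases n) auto
    show ?thesis
      unfolding n sum.atLeast0_atMost_Suc diff_Suc_1 diff_self_eq_0 g0 T_poly_eq_False by simp
  qed
  also have "(\<Sum>k=0..n - 1. of_nat (n choose k) *
      list_gf (list_as False) {..<k} * list_gf ?g {..<n - k}) = monom 1 2 *
      (\<Sum>k = 0..n - 1. of_nat (n choose k) * T_poly k * pcompose (W_poly (n - k)) (monom 1 2))"
    unfolding sum_distrib_left
  proof (intro sum.cong refl)
    fix k assume "k \<in> {0..n - 1}"
    then have "n - k > 0" using assms by auto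
    then show "of_nat (n choose k) * list_gf (list_as False) {..<k} * list_gf ?g {..<n - k} =
      monom 1 2 * (of_nat (n choose k) * T_poly k * pcompose (W_poly (n - k)) (monom 1 2))"
      by (simp only: g T_poly_eq_False mult_ac)
  qed
  finally show ?thesis
    by (simp only: T_poly_eq_False Suc_eq_plus1 add.commute)
qed

section \<open>Binomial convolutions\<close>

lemma binomial_convolution_Suc:
  fixes f :: "nat \<Rightarrow> 'a::comm_semiring_1"
  shows "(\<Sum>k = 0..n + 1. of_nat (n + 1 choose k) * f k * f (n + 1 - k)) =
    2 * (\<Sum>k = 0..n. of_nat (n choose k) * f k * f (n - k + 1))"
proof -
  let ?S = "\<Sum>k = 0..n. of_nat (n choose k) * f k * f (n - k + 1)"
  have "(\<Sum>k = 0..n + 1. of_nat (n + 1 choose k) * f k * f (n + 1 - k)) =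
      f 0 * f (n + 1) + (\<Sum>k = 0..n. of_nat (n + 1 choose (k + 1)) * f (k + 1) * f (n - k))"
    by (simp add: sum.atLeast0_atMost_Suc_shift del: sum.cl_ivl_Suc)
  also have "\<dots> = f 0 * f (n + 1) + (\<Sum>k = 0..n. of_nat (n choose (k + 1)) * f (k + 1) * f (n - k))
      + (\<Sum>k = 0..n. of_nat (n choose k) * f (k + 1) * f (n - k))"
    by (simp add: sum.distrib algebra_simps)
  \<comment> \<open>After Pascal's rule, this half is reindexed with \<open>f 0 * f (n + 1)\<close>
    as its summand at 0; the new summand at \<open>n + 1\<close> vanishes. The other half is
    reflected by \<open>k\<close> to \<open>n - k\<close>.\<close>
  also have "f 0 * f (n + 1) + (\<Sum>k = 0..n. of_nat (n choose (k + 1)) * f (k + 1) * f (n - k)) =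
      (\<Sum>k = 0..n + 1. of_nat (n choose k) * f k * f (n + 1 - k))"
    by (simp add: sum.atLeast0_atMost_Suc_shift del: sum.cl_ivl_Suc)
  also have "\<dots> = ?S"
    by (auto simp: Suc_diff_le binomial_eq_0 intro!: sum.cong)
  also have "(\<Sum>k = 0..n. of_nat (n choose k) * f (k + 1) * f (n - k)) = ?S"
    by (subst sum.atLeastAtMost_rev)
      (auto intro!: sum.cong simp: binomial_symmetric[symmetric] mult_ac)
  finally show ?thesis unfolding mult_2 .
qed

text \<open>With \<open>m = j + k\<close>, both sides sum over the same triangle of pairs, and both
  products of binomial coefficients equal the trinomial coefficient for parts \<open>k\<close>,
  \<open>j\<close> and \<open>n - m\<close>.\<close>

lemma binomial_convolution_assoc:
  fixes f g h :: "nat \<Rightarrow> 'a::comm_semiring_1"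
  shows "(\<Sum>k = 0..n. of_nat (n choose k) * f k *
      (\<Sum>j = 0..n - k. of_nat ((n - k) choose j) * g j * h (n - k - j))) =
    (\<Sum>m = 0..n. of_nat (n choose m) *
      (\<Sum>k = 0..m. of_nat (m choose k) * f k * g (m - k)) * h (n - m))"
proof -
  let ?F = "\<lambda>k m. of_nat (n choose m) * of_nat (m choose k) * f k * g (m - k) * h (n - m)"
  have "(\<Sum>k = 0..n. of_nat (n choose k) * f k *
      (\<Sum>j = 0..n - k. of_nat ((n - k) choose j) * g j * h (n - k - j))) =
    (\<Sum>k = 0..n. \<Sum>m = k..n. ?F k m)"
  proof (intro sum.cong refl)
    fix k assume k: "k \<in> {0..n}"
    have "(\<Sum>m = k..n. ?F k m) = (\<Sum>j = 0..n - k. ?F k (j + k))"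
      using k sum.shift_bounds_cl_nat_ivl[of "?F k" 0 k "n - k"] by simp
    also have "\<dots> = (\<Sum>j = 0..n - k. of_nat (n choose k) * f k *
        (of_nat ((n - k) choose j) * g j * h (n - k - j)))"
    proof (intro sum.cong refl)
      fix j assume "j \<in> {0..n - k}"
      then have "(n choose (j + k)) * ((j + k) choose k) = (n choose k) * ((n - k) choose j)"
        using choose_mult[of k "j + k" n] k by auto
      then have "of_nat (n choose (j + k)) * of_nat ((j + k) choose k) =
        (of_nat (n choose k) * of_nat ((n - k) choose j) :: 'a)"
        by (metis of_nat_mult)
      then show "?F k (j + k) =
        of_nat (n choose k) * f k * (of_nat ((n - k) choose j) * g j * h (n - k - j))"
        by (simp add: mult_ac add.commute)
    qed
    finally show "of_nat (n choose k) * f k *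
        (\<Sum>j = 0..n - k. of_nat ((n - k) choose j) * g j * h (n - k - j)) = (\<Sum>m = k..n. ?F k m)"
      by (simp add: sum_distrib_left)
  qed
  also have "\<dots> = (\<Sum>k = 0..n. \<Sum>m\<in>{m \<in> {0..n}. k \<le> m}. ?F k m)"
    by (intro sum.cong) auto
  also have "\<dots> = (\<Sum>m = 0..n. \<Sum>k\<in>{k \<in> {0..n}. k \<le> m}. ?F k m)"
    by (rule sum.swap_restrict) auto
  also have "\<dots> = (\<Sum>m = 0..n. \<Sum>k = 0..m. ?F k m)"
    by (intro sum.cong) auto
  finally show ?thesis
    by (simp add: sum_distrib_left sum_distrib_right mult.assoc)
qed

theorem corollary7:
  fixes n :: nat
  assumes "n \<ge> 1"
  shows
    "R_poly (n + 1) = (\<Sum>k = 0..n. of_nat (n choose k) * T_poly k * T_poly (n - k)) \<and>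
     R_poly (n + 2) = 2 * (\<Sum>k = 0..n. of_nat (n choose k) * T_poly k * T_poly (n - k + 1)) \<and>
     R_poly (n + 2) = 2 * monom 1 1 *
       (\<Sum>k = 0..n. of_nat (n choose k) * R_poly (k + 1) * pcompose (LW_poly (n - k)) (monom 1 2)) \<and>
     T_poly (n + 1) = monom 1 1 *
       (\<Sum>k = 0..n. of_nat (n choose k) * T_poly k * pcompose (LW_poly (n - k)) (monom 1 2)) \<and>
     T_poly (n + 1) = T_poly n + monom 1 2 *
       (\<Sum>k = 0..n - 1. of_nat (n choose k) * T_poly k * pcompose (W_poly (n - k)) (monom 1 2))"
proof -
  have "R_poly (n + 2) = (\<Sum>k = 0..n + 1. of_nat (n + 1 choose k) * T_poly k * T_poly (n + 1 - k))"
    using R_poly_Suc[of "n + 1"] by (simp add: numeral_2_eq_2)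
  then have R2: "R_poly (n + 2) = 2 * (\<Sum>k = 0..n. of_nat (n choose k) * T_poly k * T_poly (n - k + 1))"
    by (simp only: binomial_convolution_Suc)
  \<comment> \<open>\<open>T_poly_Suc_left\<close> is applied at \<open>n - k\<close>, which creates
    the nested convolution.\<close>
  also have "(\<Sum>k = 0..n. of_nat (n choose k) * T_poly k * T_poly (n - k + 1)) = monom 1 1 *
      (\<Sum>k = 0..n. of_nat (n choose k) * T_poly k *
        (\<Sum>j = 0..n - k. of_nat ((n - k) choose j) * T_poly j * pcompose (LW_poly (n - k - j)) (monom 1 2)))"
    by (subst sum_distrib_left) (intro sum.cong refl, subst T_poly_Suc_left, rule mult.left_commute)
  also have "\<dots> = monom 1 1 *
      (\<Sum>k = 0..n. of_nat (n choose k) * R_poly (k + 1) * pcompose (LW_poly (n - k)) (monom 1 2))"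
    unfolding R_poly_Suc
    by (subst binomial_convolution_assoc[of n T_poly T_poly "\<lambda>i. pcompose (LW_poly i) (monom 1 2)"]) (rule refl)
  finally have R3: "R_poly (n + 2) = 2 * monom 1 1 *
      (\<Sum>k = 0..n. of_nat (n choose k) * R_poly (k + 1) * pcompose (LW_poly (n - k)) (monom 1 2))"
    by (simp only: mult.assoc)
  show ?thesis
    by (intro conjI R_poly_Suc R2 R3 T_poly_Suc_left T_poly_Suc_interior assms)
qed

end
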